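(* Let $\mathcal{E} = (\mathcal{X}, \Theta, \{P_\theta\}_{\theta\in\Theta})$ be a statistical experiment, let $T : \mathcal{X} \rightsquigarrow \mathcal{Z}$ be a Markov kernel (a possibly randomized representation map), and let $\mathcal{F} = \mathcal{E}\circ T = (\mathcal{Z}, \Theta, \{Q_\theta\}_{\theta\in\Theta})$ with $Q_\theta = P_\theta T$ be the induced experiment. Let $(\mathcal{A}, \ell)$ be any decision problem with loss function $\ell : \Theta \times \mathcal{A} \to [0,1]$. Then for any decision rule $\rho$ on $\mathcal{F}$ there exists a decision rule $\rho'$ on $\mathcal{E}$ such that $$|R(\theta, \rho', \ell) - R(\theta, \rho, \ell)| \leq \delta(\mathcal{E}, \mathcal{F}) \quad \text{for all } \theta \in \Theta,$$ where the risk of $\rho'$ is computed in $\mathcal{E}$ and the risk of $\rho$ is computed in $\mathcal{F}$.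
   Context: A statistical experiment is a triple $(\mathcal{X}, \Theta, \{P_\theta\}_{\theta\in\Theta})$ where $\mathcal{X}$ is a measurable space, $\Theta$ is a parameter set and each $P_\theta$ is a probability measure on $\mathcal{X}$. A Markov kernel $T : \mathcal{X} \rightsquigarrow \mathcal{Y}$ assigns (measurably) to each $x\in\mathcal{X}$ a probability measure $T(x,\cdot)$ on $\mathcal{Y}$; $P_\theta T$ denotes the probability measure $B\mapsto \int T(x,B)\,P_\theta(dx)$ on $\mathcal{Y}$, and $\mathcal{E}\circ T$ denotes the experiment on $\mathcal{Y}$ with the same parameter space and distributions $P_\theta T$. For experiments $\mathcal{E} = (\mathcal{X},\Theta,\{P_\theta\})$ and $\mathcal{F}=(\mathcal{Y},\Theta,\{Q_\theta\})$ with the same parameter space, the (Le Cam) deficiency of $\mathcal{E}$ with respect to $\mathcal{F}$ is $$\delta(\mathcal{E},\mathcal{F}) = \inf_K \sup_{\theta\in\Theta} \|P_\theta K - Q_\theta\|_{TV},$$ the infimum being over all Markov kernels $K : \mathcal{X}\rightsquigarrow\mathcal{Y}$, where $\|P-Q\|_{TV} = \sup_B |P(B)-Q(B)|$ is the total variation distance. A decision problem is a pair $(\mathcal{A},\ell)$ of a (measurable) action space $\mathcal{A}$ and a bounded loss function $\ell:\Theta\times\mathcal{A}\to[0,1]$, measurable in the action. A decision rule on an experiment with sample space $\mathcal{X}$ is a possibly randomized map $\rho$ from $\mathcal{X}$ to $\mathcal{A}$ (a Markov kernel $\mathcal{X}\rightsquigarrow\mathcal{A}$), and its risk is $R(\theta,\rho,\ell)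 = \mathbb{E}_{X\sim P_\theta}[\ell(\theta,\rho(X))]$, where the expectation is also over the randomization of $\rho$. *)

theory Defs
  imports "HOL-Probability.Probability"
begin

text \<open>
  Measurable spaces are represented by values of type \<^typ>\<open>'a measure\<close> of which only the
  carrier and the sigma-algebra matter: \<open>sample_space\<close>, and the action space of a decision
  problem, are used in this way.
\<close>

record ('x, 'p) stat_experiment =
  sample_space :: "'x measure"
  param_set :: "'p set"
  dist_of :: "'p \<Rightarrow> 'x measure"

definition is_stat_experiment :: "('x, 'p) stat_experiment \<Rightarrow> bool" where
  "is_stat_experiment E \<longleftrightarrow>
     (\<forall>\<theta>\<in>param_set E. prob_space (dist_of E \<theta>) \<and> sets (dist_of E \<theta>) = sets (sample_space E))"

definition markov_kernels :: "'x measure \<Rightarrow> 'y measure \<Rightarrow> ('x \<Rightarrow> 'y measure) set" where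
  "markov_kernels X Y = X \<rightarrow>\<^sub>M prob_algebra Y"

text \<open>
  The target space is an explicit argument, since a kernel does not carry its codomain. For the
  probability measures \<open>P\<close> at hand, \<open>P \<bind> T\<close> is the measure \<open>B \<mapsto> \<integral> T(x, B) P(dx)\<close>
  (lemma \<open>emeasure_bind_prob_algebra\<close>).
\<close>

definition induced_experiment ::
    "('x, 'p) stat_experiment \<Rightarrow> 'z measure \<Rightarrow> ('x \<Rightarrow> 'z measure) \<Rightarrow> ('z, 'p) stat_experiment" where
  "induced_experiment E Z T =
     \<lparr>sample_space = Z, param_set = param_set E, dist_of = (\<lambda>\<theta>. dist_of E \<theta> \<bind> T)\<rparr>"

text \<open>
  Meant for probability measures \<open>P\<close> and \<open>Q\<close> on the same measurable space. Suprema and infima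
  are taken in \<^typ>\<open>ennreal\<close>, a complete lattice, so that they have their usual values also
  for an empty parameter set or when there is no kernel at all.
\<close>

definition total_variation :: "'y measure \<Rightarrow> 'y measure \<Rightarrow> ennreal" where
  "total_variation P Q = (SUP B\<in>sets P. ennreal \<bar>measure P B - measure Q B\<bar>)"

text \<open>Meant for experiments with \<open>param_set E = param_set F\<close>.\<close>

definition deficiency :: "('x, 'p) stat_experiment \<Rightarrow> ('y, 'p) stat_experiment \<Rightarrow> ennreal" where
  "deficiency E F =
     (INF K\<in>markov_kernels (sample_space E) (sample_space F).
        SUP \<theta>\<in>param_set E. total_variation (dist_of E \<theta> \<bind> K) (dist_of F \<theta>))"

definition decision_problem :: "'p set \<Rightarrow> 'a measure \<Rightarrow> ('p \<Rightarrow> 'a \<Rightarrow> real) \<Rightarrow> bool" where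
  "decision_problem \<Theta> A loss \<longleftrightarrow>
     (\<forall>\<theta>\<in>\<Theta>. loss \<theta> \<in> borel_measurable A \<and> (\<forall>a\<in>space A. 0 \<le> loss \<theta> a \<and> loss \<theta> a \<le> 1))"

definition decision_rules :: "('x, 'p) stat_experiment \<Rightarrow> 'a measure \<Rightarrow> ('x \<Rightarrow> 'a measure) set" where
  "decision_rules E A = markov_kernels (sample_space E) A"

definition risk ::
    "('x, 'p) stat_experiment \<Rightarrow> 'p \<Rightarrow> ('x \<Rightarrow> 'a measure) \<Rightarrow> ('p \<Rightarrow> 'a \<Rightarrow> real) \<Rightarrow> real" where
  "risk E \<theta> \<rho> loss = (\<integral>x. (\<integral>a. loss \<theta> a \<partial>(\<rho> x)) \<partial>(dist_of E \<theta>))"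

end

theory Submission
  imports Defs
begin

text \<open>
  The rule \<open>x \<mapsto> T x \<bind> \<rho>\<close>, which applies \<open>T\<close> and then \<open>\<rho>\<close>, has exactly the risk
  of \<open>\<rho>\<close>, so no property of the deficiency is needed: because \<open>F\<close> is induced from \<open>E\<close>
  by \<open>T\<close>, the difference of the risks is \<open>0\<close>.
\<close>

text \<open>Fubini for kernels: \<open>integral_bind\<close> applies because \<open>f\<close> is
  bounded and all measures involved have total mass 1. It serves twice below, first for
  \<open>dist_of E \<theta>\<close> and \<open>T\<close>, then for each \<open>T x\<close> and
  \<open>\<rho>\<close>.\<close>

lemma integral_bind_markov_kernel:
  fixes f :: "'y \<Rightarrow> real"
  assumes M: "M \<in> space (prob_algebra X)"
    and K: "K \<in> markov_kernels X Y"
    and f: "f \<in> borel_measurable Y"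
    and bounded: "\<And>y. y \<in> space Y \<Longrightarrow> \<bar>f y\<bar> \<le> B"
  shows "(\<integral>y. f y \<partial>(M \<bind> K)) = (\<integral>x. (\<integral>y. f y \<partial>(K x)) \<partial>M)"
proof -
  have sets_M: "sets M = sets X" and "prob_space M"
    using M by (auto simp: space_prob_algebra)
  interpret prob_space M by fact
  have "K \<in> M \<rightarrow>\<^sub>M subprob_algebra Y"
    using K measurable_prob_algebraD[of K X Y] measurable_cong_sets[OF sets_M refl]
    by (auto simp: markov_kernels_def)
  moreover have "emeasure (K x) (space (K x)) \<le> ennreal 1" if "x \<in> space M" for x
  proof -
    have "K x \<in> space (prob_algebra Y)"
      using K that sets_eq_imp_space_eq[OF sets_M]
      by (auto simp: markov_kernels_def dest: measurable_space)
    then show ?thesis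
      by (auto simp: space_prob_algebra prob_space.emeasure_space_1)
  qed
  \<comment> \<open>Over an empty space \<open>bind\<close> takes a default value;
    \<open>not_empty\<close> excludes this case, since a probability space has a point.\<close>
  ultimately show ?thesis
    using not_empty f bounded finite_measure_axioms
    by (intro integral_bind[where B = B and B' = 1]) auto
qed

text \<open>Both risks are the same iterated integral of the loss, over \<open>\<rho> z\<close>,
  then \<open>T x\<close>, then \<open>dist_of E \<theta>\<close>: this is associativity of kernel
  composition, tested against the loss.\<close>

lemma risk_induced_experiment:
  assumes E: "is_stat_experiment E" and \<theta>: "\<theta> \<in> param_set E"
    and T: "T \<in> markov_kernels (sample_space E) Z"
    and dp: "decision_problem (param_set E) A loss"
    and \<rho>: "\<rho> \<in> markov_kernels Z A"
  shows "risk (induced_experiment E Z T) \<theta> \<rho> loss = risk E \<theta> (\<lambda>x. T x \<bind> \<rho>) loss"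
proof -
  let ?P = "dist_of E \<theta>" and ?g = "\<lambda>z. \<integral>a. loss \<theta> a \<partial>(\<rho> z)"
  have P: "?P \<in> space (prob_algebra (sample_space E))"
    using E \<theta> by (auto simp: is_stat_experiment_def space_prob_algebra)
  have loss: "loss \<theta> \<in> borel_measurable A"
    and loss_range: "\<And>a. a \<in> space A \<Longrightarrow> \<bar>loss \<theta> a\<bar> \<le> 1"
    using dp \<theta> by (auto simp: decision_problem_def)
  have \<rho>_subprob: "\<rho> \<in> Z \<rightarrow>\<^sub>M subprob_algebra A"
    using \<rho> by (auto simp: markov_kernels_def intro: measurable_prob_algebraD)
  have g: "?g \<in> borel_measurable Z"
    using loss \<rho>_subprob integral_measurable_subprob_algebra
    by measurable
  \<comment> \<open>\<open>?g z\<close> is the expected loss after observing \<open>z\<close>.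
    Averaging over a probability measure keeps the bound 1 on the loss, so \<open>?g\<close> is an
    admissible integrand for the kernel \<open>T\<close>.\<close>
  have g_bounded: "\<bar>?g z\<bar> \<le> 1" if "z \<in> space Z" for z
  proof -
    have "\<rho> z \<in> space (prob_algebra A)"
      using \<rho> that by (auto simp: markov_kernels_def dest: measurable_space)
    then have sets_\<rho>: "sets (\<rho> z) = sets A" and "prob_space (\<rho> z)"
      by (auto simp: space_prob_algebra)
    interpret prob_space "\<rho> z" by fact
    have "loss \<theta> \<in> borel_measurable (\<rho> z)"
      using loss measurable_cong_sets[OF sets_\<rho> refl] by blast
    then have "integrable (\<rho> z) (loss \<theta>)"
      using loss_range sets_eq_imp_space_eq[OF sets_\<rho>]
      by (intro integrable_const_bound[where B = 1]) auto
    then have "\<bar>?g z\<bar> \<le> (\<integral>a. \<bar>loss \<theta> a\<bar> \<partial>(\<rho> z))" "integrable (\<rho> z) (\<lambda>a. \<bar>loss \<theta> a\<bar>)"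
      by (auto simp: integral_abs_bound)
    moreover have "(\<integral>a. \<bar>loss \<theta> a\<bar> \<partial>(\<rho> z)) \<le> 1"
      using loss_range sets_eq_imp_space_eq[OF sets_\<rho>] calculation(2)
      by (intro integral_le_const) auto
    ultimately show ?thesis by linarith
  qed
  have "risk (induced_experiment E Z T) \<theta> \<rho> loss = (\<integral>x. (\<integral>z. ?g z \<partial>(T x)) \<partial>?P)"
    unfolding risk_def induced_experiment_def
    using integral_bind_markov_kernel[OF P T g g_bounded] by simp
  \<comment> \<open>With \<open>x\<close> fixed, \<open>T x\<close> is itself a probability measure
    on \<open>Z\<close> and takes the role of \<open>M\<close>, with \<open>\<rho>\<close> as the
    kernel.\<close>
  also have "\<dots> = (\<integral>x. (\<integral>a. loss \<theta> a \<partial>(T x \<bind> \<rho>)) \<partial>?P)"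
  proof (rule Bochner_Integration.integral_cong[OF refl])
    fix x assume "x \<in> space ?P"
    then have "x \<in> space (sample_space E)"
      using P by (auto simp: space_prob_algebra dest: sets_eq_imp_space_eq)
    then have "T x \<in> space (prob_algebra Z)"
      using T by (auto simp: markov_kernels_def dest: measurable_space)
    then show "(\<integral>z. ?g z \<partial>(T x)) = (\<integral>a. loss \<theta> a \<partial>(T x \<bind> \<rho>))"
      using integral_bind_markov_kernel[OF _ \<rho> loss loss_range] by simp
  qed
  finally show ?thesis
    by (simp add: risk_def)
qed

theorem theorem3p2:
  fixes E :: "('x, 'p) stat_experiment" and F :: "('z, 'p) stat_experiment"
    and Z :: "'z measure" and T :: "'x \<Rightarrow> 'z measure"
    and A :: "'a measure" and loss :: "'p \<Rightarrow> 'a \<Rightarrow> real"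
    and \<rho> :: "'z \<Rightarrow> 'a measure"
  assumes "is_stat_experiment E"
    and "T \<in> markov_kernels (sample_space E) Z"
    and "F = induced_experiment E Z T"
    and "decision_problem (param_set E) A loss"
    and "\<rho> \<in> decision_rules F A"
  shows "\<exists>\<rho>'\<in>decision_rules E A. \<forall>\<theta>\<in>param_set E.
           ennreal \<bar>risk E \<theta> \<rho>' loss - risk F \<theta> \<rho> loss\<bar> \<le> deficiency E F"
proof (rule bexI[of _ "\<lambda>x. T x \<bind> \<rho>"])
  have \<rho>: "\<rho> \<in> markov_kernels Z A"
    using assms(3,5) by (simp add: decision_rules_def induced_experiment_def)
  \<comment> \<open>The left side becomes \<open>ennreal 0\<close>, the least element of
    \<open>ennreal\<close>.\<close>
  show "\<forall>\<theta>\<in>param_set E.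
      ennreal \<bar>risk E \<theta> (\<lambda>x. T x \<bind> \<rho>) loss - risk F \<theta> \<rho> loss\<bar> \<le> deficiency E F"
    using risk_induced_experiment[OF assms(1) _ assms(2,4) \<rho>] assms(3) by simp
  show "(\<lambda>x. T x \<bind> \<rho>) \<in> decision_rules E A"
    using assms(2) \<rho> unfolding decision_rules_def markov_kernels_def
    by (rule measurable_bind_prob_space)
qed

end
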